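(* Let $m$ be an odd prime and let $\mathbf{u}=(x_1,x_2,x_3)\in\mathbb{Z}_m^3$. If $x_1+x_2+x_3\not\equiv 0 \pmod m$ and $x_1,x_2,x_3$ are not all equal, then $\mathrm{Per}(\mathbf{u})=P_m(3)$.
   Context: $\mathbb{Z}_m=\mathbb{Z}/m\mathbb{Z}$. The Ducci function $D:\mathbb{Z}_m^n\to\mathbb{Z}_m^n$ is $D(x_1,x_2,\dots,x_n)=(x_1+x_2,\;x_2+x_3,\;\dots,\;x_n+x_1)$ (entries reduced mod $m$); here $n=3$. $\mathrm{Per}(\mathbf{u})$, the period of $\mathbf{u}$, is the smallest integer $\beta\ge 1$ such that $D^{\alpha+\beta}(\mathbf{u})=D^{\alpha}(\mathbf{u})$ for some integer $\alpha\ge 0$. $P_m(n)=\mathrm{Per}(0,0,\dots,0,1)$ for the tuple $(0,0,\dots,0,1)\in\mathbb{Z}_m^n$. *)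

theory Defs
  imports Main "HOL-Computational_Algebra.Primes" "HOL-Number_Theory.Cong"
begin

text \<open>The ring \<open>\<int>/m\<int>\<close> is represented by the canonical residues \<open>{..<m}\<close>,
  and an \<open>n\<close>-tuple over it by a list of length \<open>n\<close> of such residues, so that equality of
  tuples over \<open>\<int>/m\<int>\<close> is equality of lists.\<close>

definition residue_tuples :: "nat \<Rightarrow> nat \<Rightarrow> nat list set" where
  "residue_tuples m n = {u. set u \<subseteq> {..<m} \<and> length u = n}"

definition ducci :: "nat \<Rightarrow> nat list \<Rightarrow> nat list" where
  "ducci m u = map2 (\<lambda>x y. (x + y) mod m) u (rotate1 u)"

lemma ducci_3: "ducci m [x, y, z] = [(x + y) mod m, (y + z) mod m, (z + x) mod m]"
  by (simp add: ducci_def)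

definition ducci_period :: "nat \<Rightarrow> nat list \<Rightarrow> nat" where
  "ducci_period m u =
     (LEAST \<beta>. 1 \<le> \<beta> \<and> (\<exists>\<alpha>. (ducci m ^^ (\<alpha> + \<beta>)) u = (ducci m ^^ \<alpha>) u))"

text \<open>The tuple \<open>(0, \<dots>, 0, 1)\<close>, meaningful for \<open>n \<ge> 1\<close>; \<open>1 mod m\<close> rather than \<open>1\<close> keeps the
  last entry canonical for \<open>m = 1\<close>.\<close>

definition basic_tuple :: "nat \<Rightarrow> nat \<Rightarrow> nat list" where
  "basic_tuple m n = replicate (n - 1) 0 @ [1 mod m]"

definition P :: "nat \<Rightarrow> nat \<Rightarrow> nat" where
  "P m n = ducci_period m (basic_tuple m n)"

lemma ducci_in_residue_tuples:
  assumes "m > 0" "u \<in> residue_tuples m n"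
  shows "ducci m u \<in> residue_tuples m n"
  using assms by (auto simp: residue_tuples_def ducci_def)

lemma funpow_ducci_in_residue_tuples:
  assumes "m > 0" "u \<in> residue_tuples m n"
  shows "(ducci m ^^ k) u \<in> residue_tuples m n"
  using assms by (induction k) (auto intro: ducci_in_residue_tuples)

lemma basic_tuple_in_residue_tuples:
  assumes "m > 0" "n > 0"
  shows "basic_tuple m n \<in> residue_tuples m n"
  using assms by (auto simp: residue_tuples_def basic_tuple_def)

text \<open>On tuples of residues the set of which the period is the least element is never empty.\<close>

lemma ducci_period_exists:
  assumes "m > 0" "u \<in> residue_tuples m n"
  shows "\<exists>\<beta>\<ge>1. \<exists>\<alpha>. (ducci m ^^ (\<alpha> + \<beta>)) u = (ducci m ^^ \<alpha>) u"
proof -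
  have "range (\<lambda>k. (ducci m ^^ k) u) \<subseteq> residue_tuples m n"
    using funpow_ducci_in_residue_tuples[OF assms] by auto
  moreover have "finite (residue_tuples m n)"
    unfolding residue_tuples_def by (rule finite_lists_length_eq) simp
  ultimately have "finite (range (\<lambda>k. (ducci m ^^ k) u))"
    by (rule finite_subset)
  then have "\<not> inj (\<lambda>k. (ducci m ^^ k) u)"
    by (auto dest: finite_imageD)
  then obtain i j where "i \<noteq> j" "(ducci m ^^ i) u = (ducci m ^^ j) u"
    unfolding inj_def by blast
  then obtain i j where ij: "i < j" "(ducci m ^^ i) u = (ducci m ^^ j) u"
    by (cases i j rule: linorder_cases) auto
  then have "(ducci m ^^ (i + (j - i))) u = (ducci m ^^ i) u"
    by simp
  moreover have "1 \<le> j - i"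
    using ij(1) by simp
  ultimately show ?thesis
    by blast
qed

end

theory Submission imports Defs begin

text \<open>
  Write \<open>T\<close> for the cyclic shift of triples and \<open>S = 1 + T + T\<^sup>2\<close> for the map that puts the
  sum of the entries into every place. Then \<open>D = 1 + T = S - T\<^sup>2\<close>. Since \<open>S T = S\<close> and
  \<open>S\<^sup>2 = 3 S\<close>, the powers of \<open>D\<close> have the closed form
  \<open>D\<^sup>k = (-1)\<^sup>k T\<^bsup>2k\<^esup> + J\<^sub>k S\<close>, where \<open>J\<^sub>k = (2\<^sup>k - (-1)\<^sup>k) / 3\<close> is the \<open>k\<close>-th Jacobsthal
  number (\<open>funpow_ducci_3\<close>). This holds for every modulus, so the cases \<open>m = 3\<close>,
  \<open>m \<equiv> 1\<close> and \<open>m \<equiv> 2\<close> modulo \<open>3\<close>, for which \<open>T\<^sup>3 - 1\<close> factors differently, need not be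
  separated.

  Let \<open>u\<close> be a nonconstant triple whose sum \<open>s\<close> is nonzero modulo the odd prime \<open>m\<close>. In
  \<open>D\<^sup>\<beta> u = u\<close> the term \<open>J\<^sub>\<beta> S u\<close> is constant, so \<open>u\<close> and \<open>(-1)\<^sup>\<beta> T\<^bsup>2\<beta>\<^esup> u\<close> differ by a constant
  triple. This forces \<open>6\<close> to divide \<open>\<beta>\<close>. With the sign \<open>-1\<close>, the triple \<open>u - T u\<close> of
  differences would be the negative of one of its own rotations; three applications of this
  rotation give the identity, so the differences would equal their own negatives and vanish.
  A nontrivial rotation with sign \<open>+1\<close> would make the entries an arithmetic progression
  that closes up after three steps, which is constant unless \<open>m = 3\<close>, when its sum
  vanishes. What remains of the equation is
  \<open>J\<^sub>\<beta> s = 0\<close>, that is, \<open>m\<close> divides \<open>J\<^sub>\<beta>\<close>. Hence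
  \<open>D\<^sup>\<beta> u = u\<close> exactly if \<open>6\<close> divides \<open>\<beta>\<close> and \<open>m\<close> divides \<open>J\<^sub>\<beta>\<close>
  (\<open>funpow_ducci_fixed_iff\<close>), a condition that does not mention \<open>u\<close>. As \<open>D\<close> preserves the
  two hypotheses on \<open>u\<close>, the same condition decides \<open>D\<^bsup>\<alpha>+\<beta>\<^esup> u = D\<^sup>\<alpha> u\<close>. All such \<open>u\<close>
  therefore have the same period, and \<open>(0, 0, 1)\<close> is one of them.
\<close>

section \<open>Closed form of the iterates\<close>

primrec jacobsthal :: "nat \<Rightarrow> int" where
  "jacobsthal 0 = 0"
| "jacobsthal (Suc k) = 2 * jacobsthal k + (-1) ^ k"

lemma residue_triple_cases:
  assumes "u \<in> residue_tuples m 3"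
  obtains x y z where "u = [x, y, z]" "x < m" "y < m" "z < m"
proof -
  have "length u = 3" and *: "set u \<subseteq> {..<m}"
    using assms by (auto simp: residue_tuples_def)
  then obtain x y z where "u = [x, y, z]"
    by (auto simp: length_Suc_conv numeral_3_eq_3)
  with * show thesis
    using that by auto
qed

lemma rotate_triple:
  "rotate n [x, y, z] =
     (if n mod 3 = 0 then [x, y, z] else if n mod 3 = 1 then [y, z, x] else [z, x, y])"
proof -
  have "n mod 3 = 0 \<or> n mod 3 = 1 \<or> n mod 3 = 2"
    by linarith
  moreover have "rotate n [x, y, z] = rotate (n mod 3) [x, y, z]"
    by (simp add: rotate_conv_mod[of n])
  ultimately show ?thesis
    by (auto simp: numeral_2_eq_2)
qed

text \<open>One step is \<open>D = S - T\<^sup>2\<close> on integer representatives, since \<open>a + b = s - c\<close>. It turns the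
  coefficients \<open>(e, j)\<close> of the rotated triple and of \<open>s\<close> into \<open>(- e, 2 j + e)\<close>.\<close>

lemma ducci_affine_step:
  fixes a b c m :: nat and e j :: int
  assumes "map int v = map (\<lambda>t. (e * int t + j * int (a + b + c)) mod int m) [a, b, c]"
  shows "map int (ducci m v) =
    map (\<lambda>t. (- e * int t + (2 * j + e) * int (a + b + c)) mod int m) [c, a, b]"
proof -
  obtain p q r where v: "v = [p, q, r]"
    using assms by (auto simp: map_eq_Cons_conv)
  let ?s = "int (a + b + c)"
  have pqr: "int p = (e * int a + j * ?s) mod int m" "int q = (e * int b + j * ?s) mod int m"
    "int r = (e * int c + j * ?s) mod int m"
    using assms v by auto
  show ?thesis
    by (simp add: v ducci_3 zmod_int pqr mod_add_eq) (simp add: algebra_simps)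
qed

lemma funpow_ducci_3:
  assumes "u \<in> residue_tuples m 3"
  shows "map int ((ducci m ^^ k) u) =
    map (\<lambda>t. ((-1) ^ k * int t + jacobsthal k * int (sum_list u)) mod int m) (rotate (2 * k) u)"
proof (induction k)
  case 0
  show ?case
    using assms by (auto elim!: residue_triple_cases)
next
  case (Suc k)
  have "rotate (2 * k) u \<in> residue_tuples m 3"
    using assms by (simp add: residue_tuples_def)
  then obtain a b c where abc: "rotate (2 * k) u = [a, b, c]"
    by (rule residue_triple_cases)
  obtain x y z where "u = [x, y, z]"
    using assms by (rule residue_triple_cases)
  then have s: "sum_list u = a + b + c"
    using abc by (simp add: rotate_triple split: if_splits)
  have "rotate (2 * Suc k) u = rotate 2 (rotate (2 * k) u)"
    by (simp add: rotate_rotate)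
  then have "rotate (2 * Suc k) u = [c, a, b]"
    using abc by (simp add: rotate_triple)
  then show ?case
    using ducci_affine_step[of "(ducci m ^^ k) u" "(-1) ^ k" "jacobsthal k" a b c m] Suc s abc
    by simp
qed

section \<open>Invariance of the hypotheses\<close>

text \<open>The condition \<open>rotate1 u \<noteq> u\<close> says that the entries of \<open>u\<close> are not all equal.\<close>

definition generic_triple :: "nat \<Rightarrow> nat list \<Rightarrow> bool" where
  "generic_triple m u \<longleftrightarrow>
     u \<in> residue_tuples m 3 \<and> \<not> m dvd sum_list u \<and> rotate1 u \<noteq> u"

text \<open>\<open>D\<close> doubles the sum, and \<open>2\<close> is invertible modulo an odd prime. If \<open>D u\<close> is constant,
  cancelling the common term of two neighbouring entries shows that \<open>u\<close> is constant.\<close>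

lemma generic_triple_ducci:
  assumes "prime m" "odd m" "generic_triple m u"
  shows "generic_triple m (ducci m u)"
proof -
  have u: "u \<in> residue_tuples m 3"
    using assms(3) by (simp add: generic_triple_def)
  then obtain x y z where xyz: "u = [x, y, z]" "x < m" "y < m" "z < m"
    by (rule residue_triple_cases)
  have "\<not> m dvd 2"
    using assms(1,2) by (metis primes_dvd_imp_eq two_is_prime_nat)
  then have "\<not> m dvd 2 * (x + y + z)"
    using assms(1,3) xyz(1) by (simp add: generic_triple_def prime_dvd_mult_iff add.assoc del: distrib_left_numeral)
  moreover have "sum_list (ducci m u) mod m = (2 * (x + y + z)) mod m"
  proof -
    have "[(x + y) mod m + ((y + z) mod m + (z + x) mod m) = (x + y) + ((y + z) + (z + x))] (mod m)"
      by (intro cong_add) simp_all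
    moreover have "(x + y) + ((y + z) + (z + x)) = 2 * (x + y + z)"
      by simp
    ultimately show ?thesis
      by (simp add: xyz ducci_3 cong_def)
  qed
  ultimately have "\<not> m dvd sum_list (ducci m u)"
    by (metis dvd_eq_mod_eq_0)
  moreover have "rotate1 (ducci m u) \<noteq> ducci m u"
  proof
    assume "rotate1 (ducci m u) = ducci m u"
    then have "(y + z) mod m = (x + y) mod m \<and> (z + x) mod m = (y + z) mod m"
      unfolding xyz(1) ducci_3 rotate1.simps append.simps list.inject by blast
    then have "[y + z = y + x] (mod m)" "[z + x = z + y] (mod m)"
      unfolding cong_def by (metis add.commute)+
    then have "[z = x] (mod m)" "[x = y] (mod m)"
      by (simp_all only: cong_add_lcancel_nat)
    then have "z = x" "x = y"
      using xyz by (blast intro: cong_less_modulus_unique_nat)+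
    then show False
      using assms(3) xyz by (simp add: generic_triple_def)
  qed
  moreover have "ducci m u \<in> residue_tuples m 3"
    using u assms(1) by (simp add: ducci_in_residue_tuples prime_gt_0_nat)
  ultimately show ?thesis
    by (simp add: generic_triple_def)
qed

lemma generic_triple_funpow_ducci:
  assumes "prime m" "odd m" "generic_triple m u"
  shows "generic_triple m ((ducci m ^^ k) u)"
  using assms by (induction k) (auto intro: generic_triple_ducci)

section \<open>Triples fixed by an iterate\<close>

text \<open>The case of sign \<open>+1\<close> and a nontrivial rotation. Going once around the cycle gives
  \<open>3 j = 0\<close>; so either \<open>j = 0\<close> and the triple is constant, or \<open>m = 3\<close> and the sum of the
  progression is \<open>0\<close>.\<close>

lemma cyclic_progression_degenerate:
  fixes m x y z j :: int
  assumes "prime m" "m dvd y + j - x" "m dvd z + j - y" "m dvd x + j - z"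
  shows "m dvd x + y + z \<or> m dvd x - y \<and> m dvd y - z"
proof -
  have "m dvd (y + j - x) + (z + j - y) + (x + j - z)"
    using assms by (intro dvd_add)
  then have "m dvd 3 * j"
    by (simp add: algebra_simps)
  then consider "m dvd 3" | "m dvd j"
    using assms(1) by (auto simp: prime_dvd_mult_iff)
  then show ?thesis
  proof cases
    case 1
    have "m dvd 3 * y + (z + j - y) - (y + j - x)"
      using 1 assms by (intro dvd_add[of m "3 * y"] dvd_diff[of m "3 * y + (z + j - y)"] dvd_mult2)
    then show ?thesis
      by (simp add: algebra_simps)
  next
    case 2
    then have "m dvd j - (y + j - x)" "m dvd j - (z + j - y)"
      using assms by (blast intro: dvd_diff)+
    then show ?thesis
      by simp
  qed
qed

text \<open>The case of sign \<open>-1\<close>, in which the rotation may be any of the three. Subtracting the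
  congruences in pairs removes \<open>j\<close>. For the trivial rotation this leaves twice each
  difference, where oddness of \<open>m\<close> enters; for the other two rotations the terms with
  equal entries cancel and the differences themselves remain.\<close>

lemma negated_rotation_degenerate:
  fixes m x y z j :: int
  assumes "prime m" "odd m"
    and "[a, b, c] \<in> {[x, y, z], [y, z, x], [z, x, y]}"
    and "m dvd - a + j - x" "m dvd - b + j - y" "m dvd - c + j - z"
  shows "m dvd x - y \<and> m dvd y - z"
proof -
  have d: "m dvd (- b + j - y) - (- a + j - x)" "m dvd (- c + j - z) - (- b + j - y)"
    "m dvd (- a + j - x) - (- c + j - z)"
    using assms by (blast intro: dvd_diff)+
  have "\<not> m dvd 2"
    using assms(1,2) by (metis primes_dvd_imp_eq two_is_prime)
  then have two: "m dvd t" if "m dvd 2 * t" for t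
    using that assms(1) by (simp add: prime_dvd_mult_iff)
  from assms(3) consider "a = x" "b = y" "c = z" | "a = y" "b = z" "c = x"
    | "a = z" "b = x" "c = y"
    by auto
  then show ?thesis
  proof cases
    case 1
    then have "m dvd 2 * (x - y)" "m dvd 2 * (y - z)"
      using d by (simp_all add: algebra_simps)
    then show ?thesis
      by (blast intro: two)
  next
    case 2
    then have "m dvd x - z" "m dvd y - x"
      using d by (simp_all add: algebra_simps)
    then show ?thesis
      using dvd_add[of m "x - z" "y - x"] by (simp add: dvd_diff_commute)
  next
    case 3
    then have "m dvd z - y" "m dvd x - z"
      using d by (simp_all add: algebra_simps)
    then show ?thesis
      using dvd_add[of m "x - z" "z - y"] by (simp add: dvd_diff_commute)
  qed
qed

lemma residue_eq_iff_dvd: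
  assumes "x < m" "y < m"
  shows "x = y \<longleftrightarrow> int m dvd int x - int y"
  using assms by (metis mod_eq_dvd_iff mod_less of_nat_eq_iff zmod_int)

text \<open>The entries of \<open>D\<^sup>\<beta> u\<close> are
  \<open>e a + j\<close>, where \<open>e\<close> is the sign, \<open>a\<close> runs through the rotated entries and \<open>j = J\<^sub>\<beta> s\<close>.
  The two degenerate cases above show that \<open>\<beta>\<close> is even and divisible by \<open>3\<close>; then \<open>e a\<close>
  is the original entry and only \<open>j = 0\<close> remains.\<close>

lemma funpow_ducci_fixed_iff:
  assumes "prime m" "odd m" "generic_triple m u"
  shows "(ducci m ^^ \<beta>) u = u \<longleftrightarrow> 6 dvd \<beta> \<and> int m dvd jacobsthal \<beta>"
proof -
  have u: "u \<in> residue_tuples m 3"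
    using assms(3) by (simp add: generic_triple_def)
  then obtain x y z where xyz: "u = [x, y, z]" "x < m" "y < m" "z < m"
    by (rule residue_triple_cases)
  define e :: int where "e = (-1) ^ \<beta>"
  define j where "j = jacobsthal \<beta> * int (x + y + z)"
  have "rotate (2 * \<beta>) u \<in> residue_tuples m 3"
    using u by (simp add: residue_tuples_def)
  then obtain a b c where abc: "rotate (2 * \<beta>) u = [a, b, c]"
    by (rule residue_triple_cases)
  have sum: "\<not> int m dvd int x + int y + int z"
    using assms(3) xyz by (metis generic_triple_def add.assoc add_0_right int_dvd_int_iff
        of_nat_add sum_list.Cons sum_list.Nil)
  have nonconst: "\<not> (int m dvd int x - int y \<and> int m dvd int y - int z)"
    using assms(3) xyz residue_eq_iff_dvd[of x m y] residue_eq_iff_dvd[of y m z]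
    by (auto simp: generic_triple_def)
  have pm: "prime (int m)" "odd (int m)"
    using assms by auto
  have entry: "(e * int t + j) mod int m = int x \<longleftrightarrow> int m dvd e * int t + j - int x"
    if "x < m" for t x
    using that by (metis mod_eq_dvd_iff mod_less zmod_int)
  have img: "map int ((ducci m ^^ \<beta>) u) =
      [(e * int a + j) mod int m, (e * int b + j) mod int m, (e * int c + j) mod int m]"
    unfolding funpow_ducci_3[OF u] abc by (simp add: xyz(1) e_def j_def add.assoc)
  have "(ducci m ^^ \<beta>) u = u \<longleftrightarrow> map int ((ducci m ^^ \<beta>) u) = map int u"
    by (simp add: inj_map_eq_map)
  also have "\<dots> \<longleftrightarrow> int m dvd e * int a + j - int x \<and> int m dvd e * int b + j - int y
      \<and> int m dvd e * int c + j - int z"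
    unfolding img using xyz by (simp add: entry)
  finally have fixed: "(ducci m ^^ \<beta>) u = u \<longleftrightarrow> \<dots>" .
  have rot: "[a, b, c] = (if \<beta> mod 3 = 0 then [x, y, z] else if \<beta> mod 3 = 1 then [z, x, y]
      else [y, z, x])"
  proof -
    have "(2 * \<beta>) mod 3 = 0 \<longleftrightarrow> \<beta> mod 3 = 0" "(2 * \<beta>) mod 3 = 1 \<longleftrightarrow> \<beta> mod 3 = 2"
      by presburger+
    then show ?thesis
      using abc xyz by (auto simp: rotate_triple)
  qed
  have even: "even \<beta>" if "(ducci m ^^ \<beta>) u = u"
  proof (rule ccontr)
    assume "odd \<beta>"
    then have "e = -1"
      by (simp add: e_def)
    then show False
      using that fixed negated_rotation_degenerate[OF pm, of "int a" "int b" "int c"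
          "int x" "int y" "int z" j] rot nonconst
      by (auto split: if_splits)
  qed
  have three: "3 dvd \<beta>" if "(ducci m ^^ \<beta>) u = u"
  proof (rule ccontr)
    assume "\<not> 3 dvd \<beta>"
    then have "\<beta> mod 3 \<noteq> 0"
      by (simp add: mod_eq_0_iff_dvd)
    then consider "[a, b, c] = [z, x, y]" | "[a, b, c] = [y, z, x]"
      using rot by metis
    moreover have "e = 1"
      using even[OF that] by (simp add: e_def)
    ultimately show False
    proof cases
      case 1
      \<comment> \<open>This rotation goes around the cycle in the opposite direction.\<close>
      have "int m dvd int y - int z" if "int m dvd int x - int z" "int m dvd int z - int y"
        using that by (simp add: dvd_diff_commute)
      moreover have "int m dvd int x - int y"
        if "int m dvd int x - int z" "int m dvd int z - int y"
        using dvd_add[OF that] by simp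
      ultimately show False
        using 1 \<open>e = 1\<close> that fixed sum nonconst
          cyclic_progression_degenerate[OF pm(1), of "int z" j "int x" "int y"]
        by (auto simp: add_ac)
    next
      case 2
      then show False
        using \<open>e = 1\<close> that fixed sum nonconst
          cyclic_progression_degenerate[OF pm(1), of "int y" j "int x" "int z"]
        by auto
    qed
  qed
  have "(ducci m ^^ \<beta>) u = u \<longleftrightarrow> int m dvd jacobsthal \<beta>" if "6 dvd \<beta>"
  proof -
    have "even \<beta>" "\<beta> mod 3 = 0"
      using that by presburger+
    then have "(ducci m ^^ \<beta>) u = u \<longleftrightarrow> int m dvd j"
      using fixed rot by (simp add: e_def)
    also have "\<dots> \<longleftrightarrow> int m dvd jacobsthal \<beta>"
      using sum pm(1) by (simp add: j_def prime_dvd_mult_iff)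
    finally show ?thesis .
  qed
  moreover have "6 dvd \<beta>" if "(ducci m ^^ \<beta>) u = u"
    using even[OF that] three[OF that] by presburger
  ultimately show ?thesis
    by blast
qed

section \<open>Equality of the periods\<close>

text \<open>\<open>D\<^bsup>\<alpha>+\<beta>\<^esup> u = D\<^sup>\<alpha> u\<close> says that \<open>D\<^sup>\<beta>\<close> fixes \<open>D\<^sup>\<alpha> u\<close>, which is again generic; so the
  preperiod \<open>\<alpha>\<close> drops out of the condition.\<close>

lemma ducci_period_generic_triple:
  assumes "prime m" "odd m" "generic_triple m u"
  shows "ducci_period m u = (LEAST \<beta>. 1 \<le> \<beta> \<and> 6 dvd \<beta> \<and> int m dvd jacobsthal \<beta>)"
proof -
  have "(ducci m ^^ (\<alpha> + \<beta>)) u = (ducci m ^^ \<alpha>) u \<longleftrightarrow> 6 dvd \<beta> \<and> int m dvd jacobsthal \<beta>"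
    for \<alpha> \<beta>
    using funpow_ducci_fixed_iff[OF assms(1,2) generic_triple_funpow_ducci[OF assms, of \<alpha>], of \<beta>]
    by (simp add: add.commute[of \<alpha>] funpow_add)
  then show ?thesis
    by (simp add: ducci_period_def)
qed

theorem theorem3:
  fixes m x1 x2 x3 :: nat
  assumes "prime m" and "odd m"
    and "[x1, x2, x3] \<in> residue_tuples m 3"
    and "\<not> [x1 + x2 + x3 = 0] (mod m)"
    and "\<not> (x1 = x2 \<and> x2 = x3)"
  shows "ducci_period m [x1, x2, x3] = P m 3"
proof -
  have "generic_triple m [x1, x2, x3]"
    using assms by (auto simp: generic_triple_def cong_0_iff add.assoc)
  moreover have "generic_triple m (basic_tuple m 3)"
  proof -
    have "1 < m"
      using assms(1) by (rule prime_gt_1_nat)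
    then have "basic_tuple m 3 = [0, 0, 1]"
      by (simp add: basic_tuple_def numeral_2_eq_2)
    then show ?thesis
      using \<open>1 < m\<close> by (simp add: generic_triple_def residue_tuples_def)
  qed
  ultimately show ?thesis
    using assms(1,2) by (simp add: P_def ducci_period_generic_triple)
qed

end
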